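(* Let $G=(V,E,w)$ be a weighted hypergraph on $N$ vertices, all of positive degree, with maximum edge cardinality $\nabla$. Then each of the tensors $A$, $K$, $K^+$, $L$, $L^+$, $\mathcal{L}$, $\mathcal{L}^+$ of $G$ is irreducible if and only if $G$ is an irreducible hypergraph.
   Context: A $k$-th order $n$-dimensional tensor $T$ is reducible if there is a non-empty proper subset $J\subsetneq[n]$ such that $T_{i_1,\ldots,i_k}=0$ whenever $i_1\in J$ and $i_2,\ldots,i_k\in[n]\setminus J$; it is irreducible otherwise. A hypergraph $G=(V,E,w)$ is reducible if $V=V_1\sqcup V_2$ with $V_1,V_2$ non-empty such that every edge $e$ with $e\cap V_1\neq\emptyset$ satisfies $|e\cap V_1|\geq2$; it is irreducible otherwise. Hypergraphs: $V=\{v_1,\dots,v_N\}$, edges are subsets of $V$ of size $\ge2$, $w:E\to\mathbb{R}_{>0}$, $\deg v=\sum_{e\ni v}w(e)$, $\nabla=\max|e|$, $E_r=\{e:|e|=r\}$, $N(r,k)=(r-1)!\cdot\frac{1}{r!}\sum_{j=0}^r(-1)^j\binom{r}{j}(r-j)^k$. All tensors are $\nabla$-th order $N$-dimensional. $A_{i_1,\ldots,i_\nabla}=w(e)/N(r,\nabla)$ if $\{v_{i_1},\ldots,v_{i_\nabla}\}=e\in E_r$, else $0$. $K$ / $K^+$: diagonal $\deg v_i$, off-diagonal $\mp A_{i_1,\ldots,i_\nabla}$. $L$ / $L^+$: diagonal $1$, off-diagonal $\mp A_{i_1,\ldots,i_\nabla}\prod_{j\in\{i_1,\ldots,i_\nabla\}}(\deg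 v_j)^{-1/\nabla}$ (product over distinct indices). $\mathcal L$ / $\mathcal L^+$: diagonal $1$, off-diagonal $\mp A_{i_1,\ldots,i_\nabla}/\deg v_{i_1}$ (minus for $K,L,\mathcal L$, plus for $K^+,L^+,\mathcal L^+$). *)

theory Defs
  imports Complex_Main
begin

text \<open>
  A tensor of order \<open>k\<close> and dimension \<open>n\<close> is represented by its entries, indexed by lists
  \<open>[i\<^sub>1, \<dots>, i\<^sub>k]\<close> of length \<open>k\<close> with members in \<open>{1..n}\<close>; values at other lists are irrelevant.
\<close>

type_synonym tensor = "nat list \<Rightarrow> real"

definition tensor_reducible :: "nat \<Rightarrow> nat \<Rightarrow> tensor \<Rightarrow> bool" where
  "tensor_reducible k n T \<longleftrightarrow>
     (\<exists>J. J \<noteq> {} \<and> J \<subset> {1..n} \<and>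
        (\<forall>i js. length (i # js) = k \<and> i \<in> J \<and> set js \<subseteq> {1..n} - J \<longrightarrow> T (i # js) = 0))"

abbreviation tensor_irreducible :: "nat \<Rightarrow> nat \<Rightarrow> tensor \<Rightarrow> bool" where
  "tensor_irreducible k n T \<equiv> \<not> tensor_reducible k n T"

definition diagonal_index :: "nat list \<Rightarrow> bool" where
  "diagonal_index is \<longleftrightarrow> (\<forall>i \<in> set is. i = hd is)"

locale weighted_hypergraph =
  fixes V :: "'a set" and E :: "'a set set" and w :: "'a set \<Rightarrow> real"
  assumes finite_vertices: "finite V"
    and edge_subset: "e \<in> E \<Longrightarrow> e \<subseteq> V"
    and edge_card: "e \<in> E \<Longrightarrow> card e \<ge> 2"
    and weight_pos: "e \<in> E \<Longrightarrow> w e > 0"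

definition hypergraph_reducible :: "'a set \<Rightarrow> 'a set set \<Rightarrow> bool" where
  "hypergraph_reducible V E \<longleftrightarrow>
     (\<exists>V1 V2. V1 \<union> V2 = V \<and> V1 \<inter> V2 = {} \<and> V1 \<noteq> {} \<and> V2 \<noteq> {} \<and>
        (\<forall>e \<in> E. e \<inter> V1 \<noteq> {} \<longrightarrow> card (e \<inter> V1) \<ge> 2))"

abbreviation hypergraph_irreducible :: "'a set \<Rightarrow> 'a set set \<Rightarrow> bool" where
  "hypergraph_irreducible V E \<equiv> \<not> hypergraph_reducible V E"

definition deg :: "'a set set \<Rightarrow> ('a set \<Rightarrow> real) \<Rightarrow> 'a \<Rightarrow> real" where
  "deg E w u = (\<Sum>e | e \<in> E \<and> u \<in> e. w e)"

definition max_edge_card :: "'a set set \<Rightarrow> nat" where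
  "max_edge_card E = Max (card ` E)"

text \<open>
  The argument \<open>v\<close> is an enumeration of the vertices by \<open>{1..N}\<close>. The tensors have order
  \<open>max_edge_card E\<close>. For an index list \<open>is\<close>, \<open>set is\<close> is the set of its distinct indices.
\<close>

definition edge_norm :: "nat \<Rightarrow> nat \<Rightarrow> real" where
  "edge_norm r k =
     fact (r - 1) * (1 / fact r *
       (\<Sum>j = 0..r. (-1) ^ j * real (r choose j) * (real r - real j) ^ k))"

definition A_tensor :: "'a set set \<Rightarrow> ('a set \<Rightarrow> real) \<Rightarrow> (nat \<Rightarrow> 'a) \<Rightarrow> tensor" where
  "A_tensor E w v is =
     (let e = v ` set is in
      if e \<in> E then w e / edge_norm (card e) (max_edge_card E) else 0)"

definition K_tensor :: "'a set set \<Rightarrow> ('a set \<Rightarrow> real) \<Rightarrow> (nat \<Rightarrow> 'a) \<Rightarrow> tensor" where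
  "K_tensor E w v is =
     (if diagonal_index is then deg E w (v (hd is)) else - A_tensor E w v is)"

definition K_plus_tensor :: "'a set set \<Rightarrow> ('a set \<Rightarrow> real) \<Rightarrow> (nat \<Rightarrow> 'a) \<Rightarrow> tensor" where
  "K_plus_tensor E w v is =
     (if diagonal_index is then deg E w (v (hd is)) else A_tensor E w v is)"

definition L_tensor :: "'a set set \<Rightarrow> ('a set \<Rightarrow> real) \<Rightarrow> (nat \<Rightarrow> 'a) \<Rightarrow> tensor" where
  "L_tensor E w v is =
     (if diagonal_index is then 1
      else - A_tensor E w v is *
             (\<Prod>j \<in> set is. deg E w (v j) powr (- 1 / real (max_edge_card E))))"

definition L_plus_tensor :: "'a set set \<Rightarrow> ('a set \<Rightarrow> real) \<Rightarrow> (nat \<Rightarrow> 'a) \<Rightarrow> tensor" where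
  "L_plus_tensor E w v is =
     (if diagonal_index is then 1
      else A_tensor E w v is *
             (\<Prod>j \<in> set is. deg E w (v j) powr (- 1 / real (max_edge_card E))))"

definition rw_L_tensor :: "'a set set \<Rightarrow> ('a set \<Rightarrow> real) \<Rightarrow> (nat \<Rightarrow> 'a) \<Rightarrow> tensor" where
  \<comment> \<open>the random walk variant, written with a calligraphic \<open>L\<close>\<close>
  "rw_L_tensor E w v is =
     (if diagonal_index is then 1 else - A_tensor E w v is / deg E w (v (hd is)))"

definition rw_L_plus_tensor :: "'a set set \<Rightarrow> ('a set \<Rightarrow> real) \<Rightarrow> (nat \<Rightarrow> 'a) \<Rightarrow> tensor" where
  "rw_L_plus_tensor E w v is =
     (if diagonal_index is then 1 else A_tensor E w v is / deg E w (v (hd is)))"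

end

theory Submission
  imports Defs "HOL-Combinatorics.Stirling"
begin

text \<open>
  Splitting off the first index turns an entry \<open>T (i # js)\<close> with \<open>i \<in> J\<close> and \<open>js\<close> outside \<open>J\<close>
  into an edge meeting \<open>v ` J\<close> in the single vertex \<open>v i\<close>, and every such edge arises this way,
  because the indices outside \<open>J\<close> can be repeated to reach the required order. Such an entry is
  off-diagonal, so for each of the tensors it vanishes exactly when the index set is not an edge.
\<close>

text \<open>Both sides count the surjections from a \<open>k\<close>-set onto an
  \<open>r\<close>-set, the left one by inclusion-exclusion; hence \<open>edge_norm r k\<close> is
  \<open>fact (r - 1) * Stirling k r\<close>. The induction shows that, for \<open>r > 0\<close>,
  both satisfy \<open>F (k + 1) r = r * (F k r + F k (r - 1))\<close>.\<close>

lemma alternating_sum_eq_fact_Stirling: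
  "(\<Sum>j = 0..r. (-1) ^ j * real (r choose j) * (real r - real j) ^ k) = fact r * real (Stirling k r)"
proof (induction k arbitrary: r)
  case 0
  show ?case
    using choose_alternating_sum[of r, where 'a = real] by (cases r) (auto simp: atLeast0AtMost)
next
  case (Suc k)
  show ?case
  proof (cases r)
    case (Suc s)
    define f where "f n j = (-1) ^ j * real (n choose j) * (real n - real j) ^ k" for n j
    have IH: "(\<Sum>j = 0..n. f n j) = fact n * real (Stirling k n)" for n
      using Suc.IH[of n] by (simp add: f_def)
    \<comment> \<open>Absorption uses up one factor \<open>r - j\<close> of the power and lowers the
      upper binomial index to \<open>s\<close>.\<close>
    have absorb: "(real r - real j) * real (r choose j) = real r * real (s choose j)" if "j \<le> r" for j
    proof -
      have "(r - j) * (r choose j) = r * (s choose j)"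
        using binomial_absorb_comp[of r j] Suc by simp
      then have "real ((r - j) * (r choose j)) = real (r * (s choose j))"
        by (rule arg_cong)
      then show ?thesis
        using that by (simp add: of_nat_diff)
    qed
    have "(\<Sum>j = 0..r. (-1) ^ j * real (r choose j) * (real r - real j) ^ Suc k)
        = real r * (\<Sum>j = 0..r. (-1) ^ j * real (s choose j) * (real r - real j) ^ k)"
      unfolding sum_distrib_left
    proof (rule sum.cong[OF refl])
      fix j assume "j \<in> {0..r}"
      then have "(-1) ^ j * (real r - real j) ^ k * ((real r - real j) * real (r choose j))
          = (-1) ^ j * (real r - real j) ^ k * (real r * real (s choose j))"
        using absorb by simp
      then show "(-1) ^ j * real (r choose j) * (real r - real j) ^ Suc k
          = real r * ((-1) ^ j * real (s choose j) * (real r - real j) ^ k)"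
        by (simp add: mult_ac)
    qed
    also have "(\<Sum>j = 0..r. (-1) ^ j * real (s choose j) * (real r - real j) ^ k)
        = (\<Sum>j = 0..r. f r j) + (\<Sum>j = 0..s. f s j)"
    proof -
      \<comment> \<open>Pascal's rule writes \<open>s choose Suc j\<close> as
        \<open>(r choose Suc j) - (s choose j)\<close>; the sign flipped by the shift turns the
        subtracted part into \<open>+ f s j\<close>.\<close>
      have "(\<Sum>j = 0..s. (-1) ^ Suc j * real (s choose Suc j) * (real s - real j) ^ k)
          = (\<Sum>j = 0..s. f r (Suc j)) + (\<Sum>j = 0..s. f s j)"
        unfolding sum.distrib[symmetric]
        by (rule sum.cong[OF refl]) (simp add: f_def Suc algebra_simps)
      then show ?thesis
        unfolding Suc sum.atLeast0_atMost_Suc_shift by (simp add: f_def Suc)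
    qed
    finally show ?thesis
      unfolding IH by (simp add: Suc algebra_simps)
  qed simp
qed

lemma Stirling_pos:
  assumes "0 < r" "r \<le> k"
  shows "0 < Stirling k r"
  using assms
proof (induction k arbitrary: r)
  case (Suc k)
  then obtain s where "r = Suc s"
    by (cases r) auto
  with Suc show ?case
    \<comment> \<open>In the recurrence the summand \<open>Stirling k s\<close> is positive if
      \<open>s > 0\<close> or \<open>k = 0\<close>; otherwise \<open>Stirling k 1\<close>
      is.\<close>
    by (cases "s = 0"; cases "k = s") (auto simp: Suc_le_eq)
qed simp

lemma edge_norm_pos:
  assumes "0 < r" "r \<le> k"
  shows "0 < edge_norm r k"
  unfolding edge_norm_def alternating_sum_eq_fact_Stirling using Stirling_pos[OF assms] by simp

text \<open>Index lists have a fixed length while edges vary in size; repeating an element pads the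
  shorter ones.\<close>

lemma ex_list_with_set_and_length:
  assumes "finite S" "S \<noteq> {}" "card S \<le> n"
  obtains xs where "set xs = S" "length xs = n"
proof -
  obtain ys where ys: "set ys = S" "distinct ys"
    using finite_distinct_list[OF assms(1)] by blast
  then have "length ys \<le> n" "ys \<noteq> []"
    using assms distinct_card[of ys] by auto
  then have "set (replicate (n - length ys) (hd ys) @ ys) = S"
    using ys(1) by auto
  moreover have "length (replicate (n - length ys) (hd ys) @ ys) = n"
    using \<open>length ys \<le> n\<close> by simp
  ultimately show thesis
    using that by blast
qed

context weighted_hypergraph
begin

lemma finite_edges: "finite E"
  by (rule finite_subset[of _ "Pow V"]) (auto simp: finite_vertices dest: edge_subset)

lemma finite_edge: "e \<in> E \<Longrightarrow> finite e"
  using edge_subset finite_vertices finite_subset by blast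

lemma card_le_max_edge_card: "e \<in> E \<Longrightarrow> card e \<le> max_edge_card E"
  unfolding max_edge_card_def by (simp add: finite_edges)

text \<open>On an edge the entry is a quotient of positive numbers: the edge size lies between 2 and
  the order, where \<open>edge_norm\<close> is positive.\<close>

lemma A_tensor_eq_0_iff: "A_tensor E w v is = 0 \<longleftrightarrow> v ` set is \<notin> E"
proof (cases "v ` set is \<in> E")
  case True
  have "0 < edge_norm (card (v ` set is)) (max_edge_card E)"
    using edge_card[OF True] card_le_max_edge_card[OF True] by (intro edge_norm_pos) linarith+
  with True weight_pos[OF True] show ?thesis
    by (simp add: A_tensor_def Let_def)
qed (simp add: A_tensor_def Let_def)

text \<open>Reducibility tests only entries whose first index does not recur, so \<open>T\<close> is
  constrained only there. Diagonal values do not enter once the order is at least 2, and one proof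
  serves all the tensors.\<close>

lemma tensor_reducible_iff_hypergraph_reducible:
  assumes v: "bij_betw v {1..N} V"
    and T: "\<And>i js. \<lbrakk>length (i # js) = max_edge_card E; i \<in> {1..N}; set js \<subseteq> {1..N} - {i}\<rbrakk>
      \<Longrightarrow> T (i # js) = 0 \<longleftrightarrow> v ` set (i # js) \<notin> E"
  shows "tensor_reducible (max_edge_card E) N T \<longleftrightarrow> hypergraph_reducible V E"
proof -
  have inj: "inj_on v {1..N}" and img: "v ` {1..N} = V"
    using v by (simp_all add: bij_betw_def)
  show ?thesis
  proof
    assume "tensor_reducible (max_edge_card E) N T"
    then obtain J where J: "J \<noteq> {}" "J \<subset> {1..N}"
      and zero: "\<And>i js. \<lbrakk>length (i # js) = max_edge_card E; i \<in> J; set js \<subseteq> {1..N} - J\<rbrakk>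
        \<Longrightarrow> T (i # js) = 0"
      unfolding tensor_reducible_def by metis
    have edges: "2 \<le> card (e \<inter> v ` J)" if e: "e \<in> E" and meet: "e \<inter> v ` J \<noteq> {}" for e
    proof (rule ccontr)
      assume "\<not> 2 \<le> card (e \<inter> v ` J)"
      moreover have "card (e \<inter> v ` J) \<noteq> 0"
        using meet finite_edge[OF e] by simp
      ultimately have "card (e \<inter> v ` J) = 1"
        by linarith
      then obtain u where u: "e \<inter> v ` J = {u}"
        by (auto simp: card_1_singleton_iff)
      then obtain i where i: "i \<in> J" "u = v i"
        by blast
      \<comment> \<open>The tail of the index list has to cover the vertices of \<open>e\<close>
        other than \<open>u\<close>.\<close>
      define S where "S = {j \<in> {1..N}. v j \<in> e - {u}}"
      have image_S: "v ` S = e - {u}"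
        using edge_subset[OF e] unfolding img[symmetric] S_def by blast
      have "inj_on v S"
        using inj by (rule inj_on_subset) (auto simp: S_def)
      moreover have "u \<in> e"
        using u by blast
      ultimately have "card S = card e - 1"
        using card_image[of v S] image_S by (simp add: card_Diff_singleton)
      \<comment> \<open>Since \<open>card e \<ge> 2\<close>, \<open>S\<close> has an element to
        repeat; removing \<open>u\<close> makes \<open>S\<close> fit into the tail.\<close>
      then have "S \<noteq> {}" "card S \<le> max_edge_card E - 1"
        using edge_card[OF e] card_le_max_edge_card[OF e] by auto
      moreover have "finite S"
        by (simp add: S_def)
      ultimately obtain js where js: "set js = S" "length js = max_edge_card E - 1"
        using ex_list_with_set_and_length by blast
      have S: "S \<subseteq> {1..N} - J"
        using u by (auto simp: S_def)
      have len: "length (i # js) = max_edge_card E"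
        using js(2) edge_card[OF e] card_le_max_edge_card[OF e] by simp
      have "T (i # js) = 0"
        using zero[OF len i(1)] S js(1) by simp
      moreover have "v ` set (i # js) = e"
        using image_S i u js(1) by auto
      ultimately show False
        using T[OF len] i(1) J(2) S js(1) e by blast
    qed
    have "v ` J \<subseteq> V"
      using J(2) img by blast
    moreover have "V - v ` J \<noteq> {}"
    proof -
      \<comment> \<open>Injectivity of \<open>v\<close> keeps the image of a proper subset
        proper.\<close>
      have "v ` J \<noteq> v ` {1..N}"
        using inj_on_image_eq_iff[OF inj, of J "{1..N}"] J(2) by blast
      then show ?thesis
        using J(2) img by blast
    qed
    ultimately show "hypergraph_reducible V E"
      unfolding hypergraph_reducible_def using J(1) edges
      by (intro exI[of _ "v ` J"] exI[of _ "V - v ` J"] conjI ballI impI) (simp_all add: Un_absorb1)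
  next
    assume "hypergraph_reducible V E"
    then obtain V1 V2 where V12: "V1 \<union> V2 = V" "V1 \<inter> V2 = {}" "V1 \<noteq> {}" "V2 \<noteq> {}"
      and edges: "\<And>e. \<lbrakk>e \<in> E; e \<inter> V1 \<noteq> {}\<rbrakk> \<Longrightarrow> 2 \<le> card (e \<inter> V1)"
      unfolding hypergraph_reducible_def by metis
    define J where "J = {j \<in> {1..N}. v j \<in> V1}"
    have "V1 \<subseteq> v ` {1..N}"
      using V12(1) img by blast
    then have "v ` J = V1"
      unfolding J_def by blast
    moreover have "V1 \<noteq> V"
      using V12 by blast
    ultimately have "J \<noteq> {}" "J \<noteq> {1..N}"
      using V12(3) img by auto
    then have "J \<noteq> {}" "J \<subset> {1..N}"
      by (auto simp: J_def)
    moreover have "T (i # js) = 0"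
      if len: "length (i # js) = max_edge_card E" and i: "i \<in> J" and js: "set js \<subseteq> {1..N} - J" for i js
    proof -
      \<comment> \<open>The tail avoids \<open>V1\<close>, so only one vertex remains, too few for
        an edge meeting \<open>V1\<close>.\<close>
      have "v ` set (i # js) \<inter> V1 = {v i}"
        using i js by (auto simp: J_def)
      then have "v ` set (i # js) \<notin> E"
        using edges[of "v ` set (i # js)"] by auto
      moreover have "i \<in> {1..N}" "set js \<subseteq> {1..N} - {i}"
        using i js by (auto simp: J_def)
      ultimately show ?thesis
        using T[OF len] by blast
    qed
    ultimately show "tensor_reducible (max_edge_card E) N T"
      unfolding tensor_reducible_def by (intro exI[of _ J] conjI allI impI) blast+
  qed
qed

end

theorem theorem3p10:
  fixes V :: "'a set" and E :: "'a set set" and w :: "'a set \<Rightarrow> real"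
    and v :: "nat \<Rightarrow> 'a" and N :: nat
  assumes "weighted_hypergraph V E w"
    and "bij_betw v {1..N} V"
    and "\<forall>u \<in> V. deg E w u > 0"
  shows "(tensor_irreducible (max_edge_card E) N (A_tensor E w v) \<longleftrightarrow> hypergraph_irreducible V E) \<and>
         (tensor_irreducible (max_edge_card E) N (K_tensor E w v) \<longleftrightarrow> hypergraph_irreducible V E) \<and>
         (tensor_irreducible (max_edge_card E) N (K_plus_tensor E w v) \<longleftrightarrow> hypergraph_irreducible V E) \<and>
         (tensor_irreducible (max_edge_card E) N (L_tensor E w v) \<longleftrightarrow> hypergraph_irreducible V E) \<and>
         (tensor_irreducible (max_edge_card E) N (L_plus_tensor E w v) \<longleftrightarrow> hypergraph_irreducible V E) \<and>
         (tensor_irreducible (max_edge_card E) N (rw_L_tensor E w v) \<longleftrightarrow> hypergraph_irreducible V E) \<and>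
         (tensor_irreducible (max_edge_card E) N (rw_L_plus_tensor E w v) \<longleftrightarrow> hypergraph_irreducible V E)"
proof -
  interpret weighted_hypergraph V E w
    by (fact assms(1))
  have deg_pos: "0 < deg E w (v j)" if "j \<in> {1..N}" for j
    using assms(2,3) that by (auto simp: bij_betw_def)
  \<comment> \<open>A list of length 1 would be diagonal. The positive degree of \<open>v i\<close>
    provides an edge, which forces the order to be at least 2.\<close>
  have off_diagonal: "\<not> diagonal_index (i # js)"
    if len: "length (i # js) = max_edge_card E" and i: "i \<in> {1..N}" and js: "set js \<subseteq> {1..N} - {i}" for i js
  proof -
    have "{e. e \<in> E \<and> v i \<in> e} \<noteq> {}"
      using deg_pos[OF i] unfolding deg_def by (metis sum.empty less_irrefl)
    then obtain e where "e \<in> E"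
      by blast
    then have "2 \<le> length (i # js)"
      unfolding len using edge_card card_le_max_edge_card order_trans by blast
    then have "hd js \<in> set js"
      by (intro hd_in_set) auto
    moreover from this have "hd js \<noteq> i"
      using js by blast
    ultimately show ?thesis
      by (auto simp: diagonal_index_def)
  qed
  \<comment> \<open>Positive degrees matter here because \<open>0 powr c = 0\<close>.\<close>
  have normalization: "(\<Prod>j \<in> set is. deg E w (v j) powr c) \<noteq> 0" if "set is \<subseteq> {1..N}" for "is" c
    using deg_pos that by (fastforce simp: prod_zero_iff)
  note reducible_iff = tensor_reducible_iff_hypergraph_reducible[OF assms(2)]
  have "tensor_reducible (max_edge_card E) N T \<longleftrightarrow> hypergraph_reducible V E"
    if "T \<in> {A_tensor E w v, K_tensor E w v, K_plus_tensor E w v, L_tensor E w v,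
             L_plus_tensor E w v, rw_L_tensor E w v, rw_L_plus_tensor E w v}" for T
  proof (rule reducible_iff)
    fix i js
    assume *: "length (i # js) = max_edge_card E" "i \<in> {1..N}" "set js \<subseteq> {1..N} - {i}"
    have "set (i # js) \<subseteq> {1..N}"
      using *(2,3) by auto
    note nz = normalization[OF this] deg_pos[OF *(2)]
    show "T (i # js) = 0 \<longleftrightarrow> v ` set (i # js) \<notin> E"
      \<comment> \<open>Off the diagonal each tensor is \<open>A_tensor\<close> times a nonzero
        factor. Without \<open>set_simps\<close>, \<open>set (i # js)\<close> keeps the form in
        which \<open>nz\<close> states this.\<close>
      unfolding A_tensor_eq_0_iff[symmetric] using that off_diagonal[OF *] nz
      by (auto simp del: set_simps simp: K_tensor_def K_plus_tensor_def L_tensor_def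
          L_plus_tensor_def rw_L_tensor_def rw_L_plus_tensor_def)
  qed
  then show ?thesis
    by simp
qed

end
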